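(* Let $Y$ be a real random variable whose moment generating function $E[e^{tY}]$ exists for $|t|<\rho$ for some $\rho>0$. For every integer $n\ge 0$ and every real $x$, $$d_{n}^{Y}(x)=n!\sum_{k=0}^{n}\frac{(-1)^{k}}{k!}E[Y^{k}]x^{n-k}.$$ Moreover, $$d_{0}^{Y}(x)=1,\qquad d_{n}^{Y}(x)=nx\,d_{n-1}^{Y}(x)+(-1)^{n}E[Y^{n}]\quad (n\ge 1).$$
   Context: The probabilistic derangement polynomials of type 2 associated with $Y$, denoted $d_n^Y(x)$, are defined by the generating function (for $t$ near $0$) $$\frac{1}{1-xt}E\big[e^{-Yt}\big]=\sum_{n=0}^{\infty}d_{n}^{Y}(x)\frac{t^{n}}{n!}.$$ Convention: $x^0=1$. *)

theory Defs
  imports "HOL-Probability.Probability"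
begin

text \<open>
  The generating function is read analytically: for each fixed real \<open>x\<close>, the series converges
  to the left-hand side for all \<open>t\<close> in some neighbourhood of \<open>0\<close>, which may depend on \<open>x\<close>.
  By uniqueness of power series coefficients at most one sequence \<open>d\<close> has this property.
\<close>

definition derangement_egf :: "'a measure \<Rightarrow> ('a \<Rightarrow> real) \<Rightarrow> real \<Rightarrow> (nat \<Rightarrow> real) \<Rightarrow> bool" where
  "derangement_egf M Y x d \<longleftrightarrow>
     (\<forall>\<^sub>F t in nhds 0.
        (\<lambda>n. d n * (t ^ n / fact n)) sums (1 / (1 - x * t) * (\<integral>\<omega>. exp (- Y \<omega> * t) \<partial>M)))"

definition prob_derangement :: "'a measure \<Rightarrow> ('a \<Rightarrow> real) \<Rightarrow> nat \<Rightarrow> real \<Rightarrow> real" where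
  "prob_derangement M Y n x = (THE d. derangement_egf M Y x d) n"

end

theory Submission
  imports Defs
begin

text \<open>
  The generating function is a product of two power series in \<open>t\<close> that converge absolutely
  near \<open>0\<close>: the geometric series \<open>\<Sum>n. x^n * t^n\<close> and the moment series
  \<open>\<Sum>k. (-1)^k / k! * E[Y^k] * t^k\<close> of \<open>E[exp(-Y*t)]\<close>. The second expansion is the analytic
  point: integrating the exponential series term by term needs \<open>\<Sum>k. E[\<bar>Y*t\<bar>^k] / k!\<close> to converge,
  and every partial sum is at most \<open>E[exp \<bar>Y*t\<bar>] \<le> E[exp(Y*t)] + E[exp(-Y*t)]\<close>, which is finite
  for \<open>\<bar>t\<bar> < \<rho>\<close> (\<open>exp_integral_moment_series\<close>). The Cauchy product of the two series then has the
  claimed coefficients (\<open>derangement_egf_convolution\<close>).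

  These coefficients are the derangement polynomials because a power series is determined by
  its sum near \<open>0\<close> (\<open>powser_coeffs_unique\<close>), so the definite description that defines the
  polynomials denotes exactly this sequence. In the closed form, all summands but the one with
  \<open>k = n\<close> carry a factor \<open>x\<close>; taking it and the factor \<open>n\<close> of \<open>n!\<close> out leaves the closed form
  for \<open>n - 1\<close>, whence the recurrence.
\<close>

section \<open>Uniqueness of power series coefficients\<close>

text \<open>
  If the coefficients below \<open>n\<close> vanish, then the series divided by \<open>t^n\<close> is again a power series
  with sum \<open>0\<close> at each small \<open>t \<noteq> 0\<close>, and its limit at \<open>0\<close> is the coefficient with index \<open>n\<close>.
\<close>

lemma powser_zero_imp_coeffs_zero:
  fixes a :: "nat \<Rightarrow> 'a::{real_normed_field,banach}"
  assumes "\<forall>\<^sub>F t in nhds 0. (\<lambda>n. a n * t ^ n) sums 0"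
  shows "a n = 0"
proof (induction n rule: less_induct)
  case (less n)
  from assms obtain s where s: "s > 0"
    and sm: "\<And>t. norm t < s \<Longrightarrow> (\<lambda>n. a n * t ^ n) sums 0"
    unfolding eventually_nhds_metric by auto
  have "((\<lambda>_. 0) \<longlongrightarrow> a (0 + n)) (at (0::'a))"
  proof (rule powser_limit_0_strong [OF s])
    fix t :: 'a
    assume t: "t \<noteq> 0" "norm t < s"
    have "(\<lambda>i. a (i + n) * t ^ (i + n)) sums (0 - (\<Sum>i<n. a i * t ^ i))"
      using sm[OF t(2)] by (rule sums_split_initial_segment)
    also have "(\<Sum>i<n. a i * t ^ i) = 0"
      using less by (intro sum.neutral) auto
    finally have "(\<lambda>i. a (i + n) * t ^ (i + n) / t ^ n) sums ((0 - 0) / t ^ n)"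
      by (rule sums_divide)
    then show "(\<lambda>i. a (i + n) * t ^ i) sums 0"
      using t by (simp add: power_add)
  qed
  then show ?case
    using LIM_unique[OF tendsto_const] by force
qed

lemma powser_coeffs_unique:
  fixes a b :: "nat \<Rightarrow> 'a::{real_normed_field,banach}"
  assumes "\<forall>\<^sub>F t in nhds 0. (\<lambda>n. a n * t ^ n) sums f t"
    and "\<forall>\<^sub>F t in nhds 0. (\<lambda>n. b n * t ^ n) sums f t"
  shows "a = b"
proof
  fix n
  have "\<forall>\<^sub>F t in nhds 0. (\<lambda>n. (a n - b n) * t ^ n) sums 0"
    using assms by eventually_elim (auto dest: sums_diff simp: left_diff_distrib)
  then show "a n = b n"
    using powser_zero_imp_coeffs_zero[of "\<lambda>n. a n - b n" n] by simp
qed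

lemma derangement_egf_unique:
  assumes "derangement_egf M Y x d" and "derangement_egf M Y x d'"
  shows "d = d'"
proof -
  have "(\<lambda>n. d n / fact n) = (\<lambda>n. d' n / fact n)"
    using assms unfolding derangement_egf_def by (intro powser_coeffs_unique) simp_all
  then show ?thesis
    by (auto simp: fun_eq_iff)
qed

section \<open>Moments and the exponential series\<close>

lemma abs_exp_series_partial_sum_le:
  fixes y :: real
  shows "(\<Sum>k<n. \<bar>y ^ k / fact k\<bar>) \<le> exp y + exp (- y)"
proof -
  have "(\<lambda>k. \<bar>y ^ k / fact k\<bar>) sums exp \<bar>y\<bar>"
    using exp_converges[of "\<bar>y\<bar>"] by (simp add: power_abs abs_mult divide_inverse mult.commute)
  then have "(\<Sum>k<n. \<bar>y ^ k / fact k\<bar>) \<le> exp \<bar>y\<bar>"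
    using sum_le_suminf[of "\<lambda>k. \<bar>y ^ k / fact k\<bar>" "{..<n}"] by (simp add: sums_iff)
  also have "\<dots> \<le> exp y + exp (- y)"
    by (cases "y \<ge> 0") simp_all
  finally show ?thesis .
qed

text \<open>
  A single summand of the exponential series is dominated by the same bound as the partial
  sums, so the moments exist wherever both exponential moments do.
\<close>

lemma integrable_exp_series_term:
  fixes Z :: "'a \<Rightarrow> real"
  assumes [measurable]: "Z \<in> borel_measurable M"
    and "integrable M (\<lambda>\<omega>. exp (Z \<omega>))" "integrable M (\<lambda>\<omega>. exp (- Z \<omega>))"
  shows "integrable M (\<lambda>\<omega>. Z \<omega> ^ k / fact k)"
proof (rule Bochner_Integration.integrable_bound)
  show "integrable M (\<lambda>\<omega>. exp (Z \<omega>) + exp (- Z \<omega>))"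
    using assms(2,3) by simp
  have "\<bar>y ^ k / fact k\<bar> \<le> exp y + exp (- y)" for y :: real
    using abs_exp_series_partial_sum_le[of y "Suc k"]
      sum_nonneg[of "{..<k}" "\<lambda>k. \<bar>y ^ k / fact k\<bar>"] by simp
  then show "AE \<omega> in M. norm (Z \<omega> ^ k / fact k) \<le> norm (exp (Z \<omega>) + exp (- Z \<omega>))"
    by (auto intro!: AE_I2 order_trans[OF _ abs_ge_self])
qed measurable

text \<open>
  Both conclusions rest on the bound \<open>\<Sum>k<n. E[\<bar>Z\<bar>^k] / k! \<le> E[exp Z] + E[exp (-Z)]\<close>, uniform in \<open>n\<close>,
  which is the hypothesis of term-by-term integration.
\<close>

lemma exp_integral_moment_series:
  fixes Z :: "'a \<Rightarrow> real"
  assumes [measurable]: "Z \<in> borel_measurable M"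
    and int: "integrable M (\<lambda>\<omega>. exp (Z \<omega>))" "integrable M (\<lambda>\<omega>. exp (- Z \<omega>))"
  shows "(\<lambda>k. (\<integral>\<omega>. Z \<omega> ^ k \<partial>M) / fact k) sums (\<integral>\<omega>. exp (Z \<omega>) \<partial>M)"
    and "summable (\<lambda>k. norm ((\<integral>\<omega>. Z \<omega> ^ k \<partial>M) / fact k))"
proof -
  have term_int: "integrable M (\<lambda>\<omega>. Z \<omega> ^ k / fact k)" for k
    by (rule integrable_exp_series_term) (use assms in auto)
  have exp_sums: "(\<lambda>k. y ^ k / fact k) sums exp y" for y :: real
    using exp_converges[of y] by (simp add: divide_inverse mult.commute)
  have abs_summable: "summable (\<lambda>k. \<bar>y ^ k / fact k\<bar>)" for y :: real
    by (rule summableI_nonneg_bounded[OF _ abs_exp_series_partial_sum_le]) simp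
  have norm_summable: "summable (\<lambda>k. \<integral>\<omega>. norm (Z \<omega> ^ k / fact k) \<partial>M)"
  proof (rule summableI_nonneg_bounded)
    fix n
    have "(\<Sum>k<n. \<integral>\<omega>. norm (Z \<omega> ^ k / fact k) \<partial>M)
        = (\<integral>\<omega>. (\<Sum>k<n. norm (Z \<omega> ^ k / fact k)) \<partial>M)"
      by (rule Bochner_Integration.integral_sum[symmetric]) (intro integrable_norm term_int)
    also have "\<dots> \<le> (\<integral>\<omega>. exp (Z \<omega>) + exp (- Z \<omega>) \<partial>M)"
    proof (rule integral_mono)
      show "integrable M (\<lambda>\<omega>. \<Sum>k<n. norm (Z \<omega> ^ k / fact k))"
        by (intro Bochner_Integration.integrable_sum integrable_norm term_int)
    qed (use int abs_exp_series_partial_sum_le in auto)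
    finally show "(\<Sum>k<n. \<integral>\<omega>. norm (Z \<omega> ^ k / fact k) \<partial>M)
        \<le> (\<integral>\<omega>. exp (Z \<omega>) + exp (- Z \<omega>) \<partial>M)" .
  qed simp
  have "(\<lambda>k. \<integral>\<omega>. Z \<omega> ^ k / fact k \<partial>M) sums (\<integral>\<omega>. (\<Sum>k. Z \<omega> ^ k / fact k) \<partial>M)"
    using abs_summable by (intro sums_integral term_int norm_summable) auto
  then show "(\<lambda>k. (\<integral>\<omega>. Z \<omega> ^ k \<partial>M) / fact k) sums (\<integral>\<omega>. exp (Z \<omega>) \<partial>M)"
    using sums_unique[OF exp_sums] by simp
  show "summable (\<lambda>k. norm ((\<integral>\<omega>. Z \<omega> ^ k \<partial>M) / fact k))"
  proof (rule summable_comparison_test'[OF norm_summable])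
    fix k
    show "norm (norm ((\<integral>\<omega>. Z \<omega> ^ k \<partial>M) / fact k)) \<le> (\<integral>\<omega>. norm (Z \<omega> ^ k / fact k) \<partial>M)"
      using integral_norm_bound[of M "\<lambda>\<omega>. Z \<omega> ^ k / fact k"] by simp
  qed
qed

section \<open>The coefficients of the generating function\<close>

lemma derangement_egf_convolution:
  fixes Y :: "'a \<Rightarrow> real" and \<rho> x :: real
  assumes Y: "Y \<in> borel_measurable M"
    and "\<rho> > 0"
    and mgf: "\<And>t. \<bar>t\<bar> < \<rho> \<Longrightarrow> integrable M (\<lambda>\<omega>. exp (t * Y \<omega>))"
  shows "derangement_egf M Y x
    (\<lambda>n. fact n * (\<Sum>k=0..n. (- 1) ^ k / fact k * (\<integral>\<omega>. Y \<omega> ^ k \<partial>M) * x ^ (n - k)))"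
proof -
  have egf: "(\<lambda>n. fact n * (\<Sum>k=0..n. (- 1) ^ k / fact k * (\<integral>\<omega>. Y \<omega> ^ k \<partial>M) * x ^ (n - k))
        * (t ^ n / fact n)) sums (1 / (1 - x * t) * (\<integral>\<omega>. exp (- Y \<omega> * t) \<partial>M))"
    if t: "\<bar>t\<bar> < \<rho>" and xt: "\<bar>x * t\<bar> < 1" for t
  proof -
    let ?m = "\<lambda>k. (\<integral>\<omega>. (- Y \<omega> * t) ^ k \<partial>M) / fact k"
    have int: "integrable M (\<lambda>\<omega>. exp (- Y \<omega> * t))" "integrable M (\<lambda>\<omega>. exp (- (- Y \<omega> * t)))"
      using mgf[of "- t"] mgf[of t] t by (simp_all add: mult.commute)
    have Z: "(\<lambda>\<omega>. - Y \<omega> * t) \<in> borel_measurable M"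
      using Y by measurable
    have moments: "?m sums (\<integral>\<omega>. exp (- Y \<omega> * t) \<partial>M)" "summable (\<lambda>k. norm (?m k))"
      using exp_integral_moment_series[OF Z int] by auto
    have geometric: "(\<lambda>k. (x * t) ^ k) sums (1 / (1 - x * t))"
      using xt by (intro geometric_sums) simp
    have "summable (\<lambda>k. norm ((x * t) ^ k))"
      using summable_geometric[of "\<bar>x * t\<bar>"] xt by (simp add: power_abs)
    from Cauchy_product_sums[OF moments(2) this]
    have "(\<lambda>n. \<Sum>k\<le>n. ?m k * (x * t) ^ (n - k))
        sums ((\<integral>\<omega>. exp (- Y \<omega> * t) \<partial>M) * (1 / (1 - x * t)))"
      using moments(1) geometric by (simp add: sums_iff)
    moreover have "(\<Sum>k\<le>n. ?m k * (x * t) ^ (n - k)) =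
        fact n * (\<Sum>k=0..n. (- 1) ^ k / fact k * (\<integral>\<omega>. Y \<omega> ^ k \<partial>M) * x ^ (n - k))
          * (t ^ n / fact n)" for n
    proof -
      have "?m k * (x * t) ^ (n - k) =
          (- 1) ^ k / fact k * (\<integral>\<omega>. Y \<omega> ^ k \<partial>M) * x ^ (n - k) * t ^ n" if "k \<le> n" for k
      proof -
        have "(- Y \<omega> * t) ^ k = (- 1) ^ k * t ^ k * Y \<omega> ^ k" for \<omega>
          by (simp only: power_mult_distrib power_minus[of "Y \<omega>"] mult_ac)
        then have "?m k = (- 1) ^ k * t ^ k * (\<integral>\<omega>. Y \<omega> ^ k \<partial>M) / fact k"
          by simp
        moreover have "t ^ n = t ^ k * t ^ (n - k)"
          using that by (simp flip: power_add)
        ultimately show ?thesis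
          by (simp add: power_mult_distrib)
      qed
      then show ?thesis
        by (simp add: sum_distrib_right atMost_atLeast0)
    qed
    ultimately show ?thesis
      by (simp add: mult.commute)
  qed
  have "\<forall>\<^sub>F t in nhds 0. \<bar>t\<bar> < \<rho>"
    using \<open>\<rho> > 0\<close> by (auto simp: eventually_nhds_metric intro!: exI[of _ \<rho>])
  moreover have "\<forall>\<^sub>F t in nhds 0. \<bar>x * t\<bar> < 1"
  proof (rule order_tendstoD)
    show "((\<lambda>t. \<bar>x * t\<bar>) \<longlongrightarrow> \<bar>x * 0\<bar>) (nhds 0)"
      by (intro tendsto_intros filterlim_ident)
  qed simp
  ultimately show ?thesis
    unfolding derangement_egf_def by eventually_elim (rule egf)
qed

lemma prob_derangement_eqI:
  assumes "derangement_egf M Y x d"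
  shows "prob_derangement M Y n x = d n"
proof -
  have "(THE d. derangement_egf M Y x d) = d"
    using assms derangement_egf_unique by blast
  then show ?thesis
    by (simp add: prob_derangement_def)
qed

theorem theorem2p9:
  fixes M :: "'a measure" and Y :: "'a \<Rightarrow> real" and \<rho> :: real
  assumes "prob_space M"
    and "Y \<in> borel_measurable M"
    and "\<rho> > 0"
    and "\<And>t :: real. \<bar>t\<bar> < \<rho> \<Longrightarrow> integrable M (\<lambda>\<omega>. exp (t * Y \<omega>))"
  shows "(\<forall>(n :: nat) (x :: real). prob_derangement M Y n x =
            fact n * (\<Sum>k=0..n. (- 1) ^ k / fact k * (\<integral>\<omega>. Y \<omega> ^ k \<partial>M) * x ^ (n - k))) \<and>
         (\<forall>x :: real. prob_derangement M Y 0 x = 1) \<and>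
         (\<forall>(n :: nat) (x :: real). n \<ge> 1 \<longrightarrow> prob_derangement M Y n x =
            real n * x * prob_derangement M Y (n - 1) x + (- 1) ^ n * (\<integral>\<omega>. Y \<omega> ^ n \<partial>M))"
proof -
  have closed_form: "prob_derangement M Y n x =
      fact n * (\<Sum>k=0..n. (- 1) ^ k / fact k * (\<integral>\<omega>. Y \<omega> ^ k \<partial>M) * x ^ (n - k))" for n x
    by (rule prob_derangement_eqI[OF derangement_egf_convolution[OF assms(2-4)]])
  have initial: "prob_derangement M Y 0 x = 1" for x
    using assms(1) by (simp add: closed_form prob_space.prob_space)
  have recurrence: "prob_derangement M Y (Suc m) x =
      real (Suc m) * x * prob_derangement M Y m x + (- 1) ^ Suc m * (\<integral>\<omega>. Y \<omega> ^ Suc m \<partial>M)" for m x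
  proof -
    let ?c = "\<lambda>k. (- 1) ^ k / fact k * (\<integral>\<omega>. Y \<omega> ^ k \<partial>M)"
    have "(\<Sum>k=0..m. ?c k * x ^ (Suc m - k)) = x * (\<Sum>k=0..m. ?c k * x ^ (m - k))"
      unfolding sum_distrib_left by (intro sum.cong) (auto simp: Suc_diff_le)
    then have "(\<Sum>k=0..Suc m. ?c k * x ^ (Suc m - k)) =
        x * (\<Sum>k=0..m. ?c k * x ^ (m - k)) + ?c (Suc m)"
      by simp
    then have "prob_derangement M Y (Suc m) x =
        fact (Suc m) * (x * (\<Sum>k=0..m. ?c k * x ^ (m - k)) + ?c (Suc m))"
      unfolding closed_form by (rule arg_cong)
    also have "\<dots> = real (Suc m) * x * (fact m * (\<Sum>k=0..m. ?c k * x ^ (m - k)))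
        + fact (Suc m) * ?c (Suc m)"
      unfolding fact_Suc by (simp only: distrib_left mult_ac of_nat_mult)
    also have "fact (Suc m) * ?c (Suc m) = (- 1) ^ Suc m * (\<integral>\<omega>. Y \<omega> ^ Suc m \<partial>M)"
      by (simp del: fact_Suc power_Suc)
    finally show ?thesis
      unfolding closed_form .
  qed
  have "prob_derangement M Y n x =
      real n * x * prob_derangement M Y (n - 1) x + (- 1) ^ n * (\<integral>\<omega>. Y \<omega> ^ n \<partial>M)"
    if "n \<ge> 1" for n x
    using recurrence[of "n - 1" x] that by simp
  with closed_form initial show ?thesis
    by blast
qed

end
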